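(* As formal power series in $q$, \[ \frac{(-q;q^2)_\infty}{(q;q^2)_\infty} = \sum_{n\geq k\geq 0}q^{2k+(n-k)^2}\,Y_{q^4}(n,k)\,(q^2;q^2)_{n+k}^{-1}\,[2(n-k)+2]_q . \]
   Context: $(a;q)_k=\prod_{j=0}^{k-1}(1-aq^j)$, $(a;q)_0=1$, $(a;q)_\infty=\prod_{j\ge0}(1-aq^j)$ (and likewise with base $q^2$). For $m\ge 0$: $[m]_q=1+q+\cdots+q^{m-1}$, $[m]_q!=[m]_q[m-1]_q\cdots[1]_q$, and for $m\ge j\ge 0$, $\begin{bmatrix} m\\ j\end{bmatrix}_q=\frac{[m]_q!}{[j]_q![m-j]_q!}$. For $m\ge j\ge 0$ the $q$-Yamanouchi number is $Y_q(m,j)=\frac{[m-j+1]_q}{[m+1]_q}\begin{bmatrix} m+j\\ m\end{bmatrix}_q$; $Y_{q^4}$ denotes this with $q$ replaced by $q^4$. *)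

theory Defs
  imports "HOL-Analysis.Analysis"
begin

definition qpoch :: "'b::comm_ring_1 \<Rightarrow> 'b \<Rightarrow> nat \<Rightarrow> 'b" where
  "qpoch a q k = (\<Prod>j<k. 1 - a * q ^ j)"

definition qpoch_inf :: "'b::{t2_space, comm_ring_1} \<Rightarrow> 'b \<Rightarrow> 'b" where
  "qpoch_inf a q = (\<Prod>j. 1 - a * q ^ j)"

definition qint :: "'b::comm_ring_1 \<Rightarrow> nat \<Rightarrow> 'b" where
  "qint q m = (\<Sum>i<m. q ^ i)"

definition qfact :: "'b::comm_ring_1 \<Rightarrow> nat \<Rightarrow> 'b" where
  "qfact q m = (\<Prod>i=1..m. qint q i)"

text \<open>
  The quotients below are only meant for \<^prop>\<open>j \<le> m\<close> and for a base with zero constant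
  coefficient: all denominators then have constant coefficient 1, so that they are units and
  the division of formal power series is exact.
\<close>

definition qbinomial :: "'a::field fps \<Rightarrow> nat \<Rightarrow> nat \<Rightarrow> 'a fps" where
  "qbinomial q m j = qfact q m / (qfact q j * qfact q (m - j))"

definition qYamanouchi :: "'a::field fps \<Rightarrow> nat \<Rightarrow> nat \<Rightarrow> 'a fps" where
  "qYamanouchi q m j = qint q (m - j + 1) / qint q (m + 1) * qbinomial q (m + j) m"

lemma fps_nth_0_qint:
  fixes q :: "'a::field fps"
  assumes "fps_nth q 0 = 0" "m > 0"
  shows "fps_nth (qint q m) 0 = 1"
proof -
  have "fps_nth (qint q m) 0 = (\<Sum>i<m. if i = 0 then 1 else 0)"
    unfolding qint_def fps_sum_nth by (intro sum.cong) (auto simp: assms(1) fps_nth_power_0)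
  with assms(2) show ?thesis by simp
qed

lemma fps_nth_0_prod_one:
  fixes f :: "'b \<Rightarrow> 'a::field fps"
  assumes "\<And>x. x \<in> A \<Longrightarrow> fps_nth (f x) 0 = 1"
  shows "fps_nth (prod f A) 0 = 1"
  using assms by (induction A rule: infinite_finite_induct) auto

lemma fps_nth_0_qfact:
  fixes q :: "'a::field fps"
  assumes "fps_nth q 0 = 0"
  shows "fps_nth (qfact q m) 0 = 1"
  unfolding qfact_def using assms by (intro fps_nth_0_prod_one fps_nth_0_qint) auto

text \<open>
  In the coefficientwise topology of formal power series the infinite products in question
  converge, to a series with constant coefficient 1; hence \<^const>\<open>qpoch_inf\<close> is not a
  default value there and dividing by it is exact.
\<close>

lemma fps_nth_mult_power_eq_0:
  fixes F a q :: "'a::field fps"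
  assumes "fps_nth a 0 = 0" "fps_nth q 0 = 0" "n \<le> N"
  shows "fps_nth (F * (a * q ^ N)) n = 0"
proof -
  define a' q' where "a' = fps_shift 1 a" and "q' = fps_shift 1 q"
  have "a = fps_X * a'" "q = fps_X * q'"
    using assms(1,2) by (auto simp: fps_eq_iff a'_def q'_def)
  hence "F * (a * q ^ N) = fps_X ^ Suc N * (F * a' * q' ^ N)"
    by (simp only: power_mult_distrib power_Suc mult_ac)
  with assms(3) show ?thesis by (simp only: fps_X_power_mult_nth) simp
qed

lemma
  fixes a q :: "'a::field fps"
  assumes a: "fps_nth a 0 = 0" and q: "fps_nth q 0 = 0"
  shows has_prod_qpoch_inf: "(\<lambda>j. 1 - a * q ^ j) has_prod qpoch_inf a q"
    and qpoch_tendsto_qpoch_inf: "qpoch a q \<longlonglongrightarrow> qpoch_inf a q"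
    and fps_nth_0_qpoch_inf: "fps_nth (qpoch_inf a q) 0 = 1"
proof -
  define P where "P = Abs_fps (\<lambda>n. fps_nth (qpoch a q n) n)"
  have stable: "fps_nth (qpoch a q N) n = fps_nth (qpoch a q n) n" if "n \<le> N" for n N
    using that
  proof (induction N rule: dec_induct)
    case (step N)
    have "qpoch a q (Suc N) = qpoch a q N - qpoch a q N * (a * q ^ N)"
      by (simp add: qpoch_def algebra_simps)
    with step fps_nth_mult_power_eq_0[OF a q, of n N "qpoch a q N"] show ?case by simp
  qed simp
  have lim: "qpoch a q \<longlonglongrightarrow> P"
  proof (rule tendsto_fpsI)
    show "\<forall>\<^sub>F N in sequentially. fps_nth (qpoch a q N) n = fps_nth P n" for n
      unfolding P_def fps_nth_Abs_fps using eventually_ge_at_top[of n] by eventually_elim (rule stable)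
  qed
  have P0: "fps_nth P 0 = 1"
    by (simp add: P_def qpoch_def)
  have lim': "(\<lambda>n. \<Prod>i\<le>n. 1 - a * q ^ i) \<longlonglongrightarrow> P"
    using LIMSEQ_Suc[OF lim] by (simp add: qpoch_def lessThan_Suc_atMost)
  with P0 have hp: "(\<lambda>j. 1 - a * q ^ j) has_prod P"
    by (auto simp: has_prod_def raw_has_prod_def)
  have "1 - a * q ^ i \<noteq> 0" for i
  proof
    assume "1 - a * q ^ i = 0"
    hence "fps_nth (1 - a * q ^ i) 0 = 0" by simp
    with a show False by simp
  qed
  hence "p = P" if "(\<lambda>j. 1 - a * q ^ j) has_prod p" for p
    using that LIMSEQ_unique[OF lim'] by (auto simp: has_prod_def raw_has_prod_def)
  with hp have "qpoch_inf a q = P"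
    unfolding qpoch_inf_def prodinf_def by (intro the_equality)
  with hp lim P0 show "(\<lambda>j. 1 - a * q ^ j) has_prod qpoch_inf a q"
    "qpoch a q \<longlonglongrightarrow> qpoch_inf a q" "fps_nth (qpoch_inf a q) 0 = 1"
    by simp_all
qed

end

theory Submission
  imports Defs
begin

text \<open>
  Write \<open>N = n + k\<close>. Expanding the $q$-Yamanouchi number as a difference of two Gaussian
  binomials, as for ballot numbers, the terms with fixed \<open>N\<close> unfold by reflection into a sum over all
  \<open>k \<le> N\<close>, which the evaluation of a Rogers--Szego polynomial turns into
  \<open>(1 + q) q\<^sup>N (-q\<^sup>2;q\<^sup>2)\<^sub>N / (q\<^sup>2;q\<^sup>2)\<^sub>N\<close>. The $q$-binomial theorem sums these over \<open>N\<close>.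
\<close>

section \<open>Gaussian binomial coefficients\<close>

text \<open>Taking the q-Pascal rule as the definition avoids division and works in any commutative
  ring. The value 0 for k > n absorbs the boundary terms of later sums.\<close>

fun gauss_binomial :: "'b::comm_ring_1 \<Rightarrow> nat \<Rightarrow> nat \<Rightarrow> 'b" where
  "gauss_binomial q n 0 = 1"
| "gauss_binomial q 0 (Suc k) = 0"
| "gauss_binomial q (Suc n) (Suc k) =
     gauss_binomial q n k + q ^ Suc k * gauss_binomial q n (Suc k)"

lemma gauss_binomial_eq_0: "n < k \<Longrightarrow> gauss_binomial q n k = 0"
  by (induction q n k rule: gauss_binomial.induct) auto

lemma gauss_binomial_n_n [simp]: "gauss_binomial q n n = 1"
  by (induction n) (auto simp: gauss_binomial_eq_0)

lemma qint_add: "qint q (a + b) = qint q a + q ^ a * qint q b"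
  by (induction b) (auto simp: qint_def algebra_simps power_add)

lemma one_minus_mult_qint: "(1 - q) * qint q m = 1 - q ^ m"
  by (simp add: qint_def one_diff_power_eq)

lemma qfact_Suc: "qfact q (Suc n) = qfact q n * qint q (Suc n)"
  by (simp add: qfact_def)

text \<open>Link to the factorial quotient, kept division-free. After multiplying the q-Pascal rule
  by the factorials, the two summands recombine through [a+1] + q^(a+1) [b+1] = [a+b+2].\<close>

lemma gauss_binomial_mult_qfact:
  "gauss_binomial q (a + b) a * (qfact q a * qfact q b) = qfact q (a + b)"
proof (induction a arbitrary: b)
  case 0
  show ?case by (simp add: qfact_def)
next
  case IH: (Suc a)
  show ?case
  proof (induction b)
    case 0
    show ?case by (simp add: qfact_def)
  next
    case (Suc b)
    have "gauss_binomial q (Suc a + Suc b) (Suc a) * (qfact q (Suc a) * qfact q (Suc b)) =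
        gauss_binomial q (a + Suc b) a * (qfact q a * qfact q (Suc b)) * qint q (Suc a)
        + q ^ Suc a * (gauss_binomial q (Suc a + b) (Suc a) * (qfact q (Suc a) * qfact q b))
          * qint q (Suc b)"
      by (simp add: qfact_Suc algebra_simps)
    also have "\<dots> = qfact q (a + Suc b) * (qint q (Suc a) + q ^ Suc a * qint q (Suc b))"
      unfolding IH Suc by (simp add: algebra_simps)
    also have "\<dots> = qfact q (Suc a + Suc b)"
      unfolding qint_add[symmetric] using qfact_Suc[of q "a + Suc b"] by simp
    finally show ?case .
  qed
qed

context
  fixes q :: "'a::field fps"
  assumes q: "fps_nth q 0 = 0"
begin

lemma qfact_nonzero: "qfact q n \<noteq> 0"
  using fps_nth_0_qfact[OF q, of n] by auto

lemma gauss_binomial_symmetric: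
  assumes "k \<le> n"
  shows "gauss_binomial q n (n - k) = gauss_binomial q n k"
proof -
  have "gauss_binomial q n (n - k) * (qfact q k * qfact q (n - k))
      = gauss_binomial q n k * (qfact q k * qfact q (n - k))"
    using gauss_binomial_mult_qfact[of q k "n - k"] gauss_binomial_mult_qfact[of q "n - k" k] assms
    by (simp add: mult_ac)
  thus ?thesis using qfact_nonzero by simp
qed

lemma qbinomial_eq_gauss_binomial:
  assumes "k \<le> n"
  shows "qbinomial q n k = gauss_binomial q n k"
proof -
  have "qfact q n = gauss_binomial q n k * (qfact q k * qfact q (n - k))"
    using gauss_binomial_mult_qfact[of q k "n - k"] assms by simp
  thus ?thesis unfolding qbinomial_def using qfact_nonzero by simp
qed

text \<open>Ratio of neighbouring Gaussian binomials: for k > 0, both sides become [n+k]! when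
  multiplied by [n]! [k-1]!.\<close>

lemma qint_mult_gauss_binomial:
  "qint q (Suc n) * gauss_binomial q (n + k) (Suc n) = qint q k * gauss_binomial q (n + k) n"
proof (cases k)
  case 0
  thus ?thesis by (simp add: gauss_binomial_eq_0 qint_def)
next
  case (Suc j)
  have "qint q (Suc n) * gauss_binomial q (n + k) (Suc n) * (qfact q n * qfact q j)
      = qint q k * gauss_binomial q (n + k) n * (qfact q n * qfact q j)"
    using gauss_binomial_mult_qfact[of q "Suc n" j] gauss_binomial_mult_qfact[of q n k]
    by (simp add: Suc qfact_Suc mult_ac)
  thus ?thesis using qfact_nonzero by simp
qed

text \<open>The q-analogue of writing a ballot number as a difference of two binomials. Clear the
  denominator [n+1], split it as [n-k+1] + q^(n-k+1) [k], and the [k] part cancels against the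
  subtracted binomial.\<close>

lemma qYamanouchi_eq_diff:
  assumes "k \<le> n"
  shows "qYamanouchi q n k =
    gauss_binomial q (n + k) k - q ^ (n - k + 1) * gauss_binomial q (n + k) (Suc n)"
proof -
  have unit: "fps_nth (qint q (n + 1)) 0 \<noteq> 0"
    using fps_nth_0_qint[OF q] by simp
  have split: "qint q (n + 1) = qint q (n - k + 1) + q ^ (n - k + 1) * qint q k"
    using qint_add[of q "n - k + 1" k] assms by simp
  have "(gauss_binomial q (n + k) n - q ^ (n - k + 1) * gauss_binomial q (n + k) (Suc n)) * qint q (n + 1)
      = gauss_binomial q (n + k) n * qint q (n + 1)
        - q ^ (n - k + 1) * (qint q (Suc n) * gauss_binomial q (n + k) (Suc n))"
    by (simp add: algebra_simps)
  also have "\<dots> = qint q (n - k + 1) * gauss_binomial q (n + k) n"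
    unfolding qint_mult_gauss_binomial split by (simp only: algebra_simps)
  finally have "qint q (n - k + 1) * gauss_binomial q (n + k) n =
      (gauss_binomial q (n + k) n - q ^ (n - k + 1) * gauss_binomial q (n + k) (Suc n)) * qint q (n + 1)"
    by (rule sym)
  moreover have "gauss_binomial q (n + k) n = gauss_binomial q (n + k) k"
    using gauss_binomial_symmetric[of k "n + k"] by simp
  ultimately show ?thesis
    using unit qbinomial_eq_gauss_binomial[of n "n + k"]
    by (simp add: qYamanouchi_def fps_divide_unit mult_ac inverse_mult_eq_1')
qed

end

section \<open>Summation over pairs with fixed $n + k$\<close>

lemma qpoch_Suc: "qpoch a q (Suc n) = qpoch a q n * (1 - a * q ^ n)"
  by (simp add: qpoch_def)

text \<open>The exponents below are such products wrapped in \<open>nat\<close>; nonnegativity means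
  that \<open>nat\<close> never truncates.\<close>

lemma int_mult_Suc_nonneg: "0 \<le> (d::int) * (d + 1)" "0 \<le> (d::int) * (d - 1)"
  by (auto simp: zero_le_mult_iff)

text \<open>
  The Rogers--Szego polynomial $\sum_k z^k {N \brack k}_p$ at $z = p^{1/2}$ and at $z = p^{-1/2}$,
  where $p = q^{-4}$, cleared of negative powers of $q$.
\<close>
lemma rogers_szego_sum:
  fixes q :: "'a::field fps"
  assumes q: "fps_nth q 0 = 0"
  shows "(\<Sum>k\<le>N. q ^ nat ((2 * int k - int N) * (2 * int k - int N - 1)) * gauss_binomial (q ^ 4) N k)
           = qpoch (- (q\<^sup>2)) (q\<^sup>2) N" (is "?L N = _")
    and "(\<Sum>k\<le>N. q ^ nat ((2 * int k - int N) * (2 * int k - int N + 1)) * gauss_binomial (q ^ 4) N k)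
           = qpoch (- (q\<^sup>2)) (q\<^sup>2) N" (is "?R N = _")
proof -
  define B where "B = gauss_binomial (q ^ 4)"
  \<comment> \<open>Reflection k -> N - k negates d = 2k - N, which exchanges d(d-1) with d(d+1),
    and the Gaussian binomial is symmetric.\<close>
  have L_eq_R: "?L N = ?R N" for N
  proof (rule sum.reindex_bij_witness[of _ "\<lambda>k. N - k" "\<lambda>k. N - k"])
    fix k assume "k \<in> {..N}"
    hence "gauss_binomial (q ^ 4) N (N - k) = gauss_binomial (q ^ 4) N k" "int (N - k) = int N - int k"
      using gauss_binomial_symmetric[of "q ^ 4" k N] q by auto
    moreover have "(2 * (int N - int k) - int N) * (2 * (int N - int k) - int N + 1)
        = (2 * int k - int N) * (2 * int k - int N - 1)"
      by (simp add: algebra_simps)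
    ultimately show "q ^ nat ((2 * int (N - k) - int N) * (2 * int (N - k) - int N + 1))
          * gauss_binomial (q ^ 4) N (N - k)
        = q ^ nat ((2 * int k - int N) * (2 * int k - int N - 1)) * gauss_binomial (q ^ 4) N k"
      by simp
  qed auto
  show L: "?L N = qpoch (- (q\<^sup>2)) (q\<^sup>2) N"
  proof (induction N)
    case 0
    show ?case by (simp add: qpoch_def)
  next
    case (Suc N)
    define w where "w k = q ^ nat ((2 * int k - int (Suc N)) * (2 * int k - int (Suc N) - 1))" for k
    \<comment> \<open>The two branches of the q-Pascal rule: with d = 2k - N, shifting k turns the
      exponent into (d+1)d, a term of \<open>?R N\<close>, while the factor q^(4k) gives (d-1)(d-2)
      + 4k = d(d-1) + 2N + 2, a term of \<open>?L N\<close>.\<close>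
    have w1: "w (Suc k) = q ^ nat ((2 * int k - int N) * (2 * int k - int N + 1))" for k
      by (simp add: w_def algebra_simps)
    have w2: "w k * q ^ (4 * k)
        = q ^ (2 * N + 2) * q ^ nat ((2 * int k - int N) * (2 * int k - int N - 1))" for k
    proof -
      have "(2 * int k - int (Suc N)) * (2 * int k - int (Suc N) - 1) + int (4 * k)
          = (2 * int k - int N) * (2 * int k - int N - 1) + int (2 * N + 2)"
        by (simp add: algebra_simps)
      hence "nat ((2 * int k - int (Suc N)) * (2 * int k - int (Suc N) - 1)) + 4 * k
          = nat ((2 * int k - int N) * (2 * int k - int N - 1)) + (2 * N + 2)"
        using int_mult_Suc_nonneg(2)[of "2 * int k - int (Suc N)"] int_mult_Suc_nonneg(2)[of "2 * int k - int N"]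
        by linarith
      thus ?thesis unfolding w_def power_add[symmetric] by (simp only: add.commute)
    qed
    have B_rec: "B (Suc N) (Suc k) = B N k + q ^ (4 * Suc k) * B N (Suc k)" for k
      by (simp only: B_def gauss_binomial.simps power_mult)
    have "?L (Suc N) = (\<Sum>k\<le>Suc N. w k * B (Suc N) k)"
      by (simp only: w_def B_def)
    also have "\<dots> = w 0 + (\<Sum>k\<le>N. w (Suc k) * B (Suc N) (Suc k))"
      by (subst sum.atMost_Suc_shift) (simp add: B_def)
    also have "(\<Sum>k\<le>N. w (Suc k) * B (Suc N) (Suc k))
        = (\<Sum>k\<le>N. w (Suc k) * B N k) + (\<Sum>k\<le>N. w (Suc k) * q ^ (4 * Suc k) * B N (Suc k))"
      by (simp only: B_rec distrib_left sum.distrib mult.assoc)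
    \<comment> \<open>\<open>w 0\<close> is the missing k = 0 term of the second sum; its top term k
      = N + 1 then vanishes with the binomial.\<close>
    also have "w 0 + \<dots> = (\<Sum>k\<le>N. w (Suc k) * B N k) + (\<Sum>k\<le>Suc N. w k * q ^ (4 * k) * B N k)"
      unfolding sum.atMost_Suc_shift[of "\<lambda>k. w k * q ^ (4 * k) * B N k"] by (simp add: B_def)
    also have "(\<Sum>k\<le>Suc N. w k * q ^ (4 * k) * B N k) = (\<Sum>k\<le>N. w k * q ^ (4 * k) * B N k)"
      by (simp add: B_def gauss_binomial_eq_0)
    also have "\<dots> = q ^ (2 * N + 2) * ?L N"
      unfolding w2 B_def by (simp add: sum_distrib_left mult_ac)
    also have "(\<Sum>k\<le>N. w (Suc k) * B N k) = ?L N"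
      unfolding w1 L_eq_R by (simp add: B_def)
    also have "?L N + q ^ (2 * N + 2) * ?L N = (1 + q ^ (2 * N + 2)) * ?L N"
      by (simp add: algebra_simps)
    also have "\<dots> = qpoch (- (q\<^sup>2)) (q\<^sup>2) (Suc N)"
      unfolding Suc qpoch_Suc power_add power_mult by (simp add: mult_ac)
    finally show ?case .
  qed
  show "?R N = qpoch (- (q\<^sup>2)) (q\<^sup>2) N"
    using L L_eq_R by simp
qed

text \<open>The map k -> N + 1 - k carries the lower half 2k \<le> N onto the upper half of 0..N+1.
  It misses only a possible midpoint 2k = N + 1, and it reaches the extra index N + 1; the two
  hypotheses make \<open>h\<close> vanish at both.\<close>

lemma sum_reflect_half:
  fixes h :: "nat \<Rightarrow> 'b::comm_monoid_add"
  assumes "h (Suc N) = 0" "\<And>k. 2 * k = Suc N \<Longrightarrow> h k = 0"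
  shows "(\<Sum>k | 2 * k \<le> N. h k + h (Suc N - k)) = (\<Sum>k\<le>N. h k)"
proof -
  have fin: "finite {k. 2 * k \<le> N}"
    by (rule finite_subset[of _ "{..N}"]) auto
  have "(\<Sum>k | 2 * k \<le> N. h (Suc N - k)) = (\<Sum>k | Suc N < 2 * k \<and> k \<le> Suc N. h k)"
    by (rule sum.reindex_bij_witness[of _ "\<lambda>k. Suc N - k" "\<lambda>k. Suc N - k"]) auto
  hence "(\<Sum>k | 2 * k \<le> N. h k + h (Suc N - k))
      = (\<Sum>k | 2 * k \<le> N. h k) + (\<Sum>k | Suc N < 2 * k \<and> k \<le> Suc N. h k)"
    by (simp add: sum.distrib)
  also have "\<dots> = (\<Sum>k \<in> {k. 2 * k \<le> N} \<union> {k. Suc N < 2 * k \<and> k \<le> Suc N}. h k)"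
    by (subst sum.union_disjoint) (use fin in auto)
  also have "\<dots> = (\<Sum>k\<le>Suc N. h k)"
  proof (rule sum.mono_neutral_left)
    show "\<forall>k\<in>{..Suc N} - ({k. 2 * k \<le> N} \<union> {k. Suc N < 2 * k \<and> k \<le> Suc N}). h k = 0"
    proof
      fix k assume "k \<in> {..Suc N} - ({k. 2 * k \<le> N} \<union> {k. Suc N < 2 * k \<and> k \<le> Suc N})"
      hence "2 * k = Suc N" by auto
      thus "h k = 0" by (rule assms(2))
    qed
  qed auto
  also have "\<dots> = (\<Sum>k\<le>N. h k)"
    using assms(1) by simp
  finally show ?thesis .
qed

text \<open>Multiplying by 1 - q turns [2m+2], where m = N - 2k, into 1 - q^(2m+2). Together with
  the two binomials of the Yamanouchi number this gives four terms, namely \<open>f - g\<close> at k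
  and at N + 1 - k, so the half sum unfolds to a full Rogers-Szego sum.\<close>

lemma sum_qYamanouchi_fixed_total:
  fixes q :: "'a::field fps"
  assumes q: "fps_nth q 0 = 0"
  shows "(\<Sum>k | 2 * k \<le> N. q ^ (2 * k + (N - k - k)\<^sup>2) * qYamanouchi (q ^ 4) (N - k) k
            * qint q (2 * (N - k - k) + 2))
         = (1 + q) * q ^ N * qpoch (- (q\<^sup>2)) (q\<^sup>2) N" (is "?S = _")
proof -
  define B where "B = gauss_binomial (q ^ 4)"
  \<comment> \<open>The exponents are written in d = 2k - N so that one formula serves both halves:
    d = -m at k, and d = m + 2 at the reflected index k + m + 1.\<close>
  define f where
    "f k = q ^ (N + nat ((2 * int k - int N) * (2 * int k - int N + 1))) * B N k" for k
  define g where
    "g k = q ^ (N + 2 + nat ((2 * int k - int N) * (2 * int k - int N - 1))) * B N k" for k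
  have q4: "fps_nth (q ^ 4) 0 = 0" using q by simp
  have fold: "(1 - q) * (q ^ (2 * k + (N - k - k)\<^sup>2) * qYamanouchi (q ^ 4) (N - k) k
      * qint q (2 * (N - k - k) + 2)) = (f k - g k) + (f (Suc N - k) - g (Suc N - k))"
    if "2 * k \<le> N" for k
  proof -
    obtain m where N: "N = 2 * k + m" using \<open>2 * k \<le> N\<close> le_Suc_ex by blast
    have [simp]: "N - k = k + m" "Suc N - k = Suc (k + m)" "k + m + k = N"
      by (simp_all add: N)
    have "int (N + nat ((2 * int k - int N) * (2 * int k - int N + 1))) = int (2 * k + m\<^sup>2)"
      using int_mult_Suc_nonneg(1)[of "2 * int k - int N"]
      by (simp add: N algebra_simps power2_eq_square)
    hence f1: "f k = q ^ (2 * k + m\<^sup>2) * B N k"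
      unfolding f_def by (metis of_nat_eq_iff)
    have "int (N + 2 + nat ((2 * int k - int N) * (2 * int k - int N - 1)))
        = int (2 * k + m\<^sup>2 + (2 * m + 2))"
      using int_mult_Suc_nonneg(2)[of "2 * int k - int N"]
      by (simp add: N algebra_simps power2_eq_square)
    hence g1: "g k = q ^ (2 * k + m\<^sup>2 + (2 * m + 2)) * B N k"
      unfolding g_def by (metis of_nat_eq_iff)
    have d: "2 * int (Suc (k + m)) - int N = int m + 2" by (simp add: N)
    have "int (N + nat ((int m + 2) * (int m + 2 + 1)))
        = int (2 * k + m\<^sup>2 + (2 * m + 2) + 4 * (m + 1))"
      by (simp add: N algebra_simps power2_eq_square)
    hence f2: "f (Suc (k + m)) = q ^ (2 * k + m\<^sup>2 + (2 * m + 2) + 4 * (m + 1)) * B N (Suc (k + m))"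
      unfolding f_def d by (metis of_nat_eq_iff)
    have "int (N + 2 + nat ((int m + 2) * (int m + 2 - 1))) = int (2 * k + m\<^sup>2 + 4 * (m + 1))"
      by (simp add: N algebra_simps power2_eq_square)
    hence g2: "g (Suc (k + m)) = q ^ (2 * k + m\<^sup>2 + 4 * (m + 1)) * B N (Suc (k + m))"
      unfolding g_def d by (metis of_nat_eq_iff)
    have Y: "qYamanouchi (q ^ 4) (k + m) k = B N k - q ^ (4 * (m + 1)) * B N (Suc (k + m))"
      using qYamanouchi_eq_diff[OF q4, of k "k + m"]
      by (simp add: B_def power_mult[symmetric] del: power_Suc)
    have "(1 - q) * (q ^ (2 * k + m\<^sup>2) * qYamanouchi (q ^ 4) (k + m) k * qint q (2 * m + 2))
        = q ^ (2 * k + m\<^sup>2) * qYamanouchi (q ^ 4) (k + m) k * ((1 - q) * qint q (2 * m + 2))"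
      by (simp only: mult_ac)
    also have "\<dots> = (f k - g k) + (f (Suc (k + m)) - g (Suc (k + m)))"
      unfolding one_minus_mult_qint Y f1 f2 g1 g2 power_add[of q "2 * k + m\<^sup>2 + _"]
        power_add[of q "2 * k + m\<^sup>2"]
      by (simp only: algebra_simps mult_1)
    finally show ?thesis by simp
  qed
  have "(1 - q) * ?S = (\<Sum>k | 2 * k \<le> N. (f k - g k) + (f (Suc N - k) - g (Suc N - k)))"
    unfolding sum_distrib_left by (rule sum.cong) (use fold in auto)
  also have "\<dots> = (\<Sum>k\<le>N. f k - g k)"
  proof (rule sum_reflect_half)
    show "f (Suc N) - g (Suc N) = 0"
      by (simp add: f_def g_def B_def gauss_binomial_eq_0)
    \<comment> \<open>At the fixed point of the reflection d = 1, where the exponents d(d+1) and 2 +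
      d(d-1) coincide.\<close>
    show "f k - g k = 0" if "2 * k = Suc N" for k
    proof -
      from that have d: "2 * int k - int N = 1" by linarith
      show ?thesis unfolding f_def g_def d by simp
    qed
  qed
  \<comment> \<open>Both sums have the same Rogers-Szego value, and q^N - q^(N+2) = (1 - q)(1 + q)
    q^N lets the auxiliary factor 1 - q cancel.\<close>
  also have "\<dots> = q ^ N * qpoch (- (q\<^sup>2)) (q\<^sup>2) N - q ^ (N + 2) * qpoch (- (q\<^sup>2)) (q\<^sup>2) N"
    unfolding sum_subtractf f_def g_def power_add[of q "N + 2"] power_add[of q N "nat _"] mult.assoc
      sum_distrib_left[symmetric] B_def
    by (simp only: rogers_szego_sum[OF q])
  also have "\<dots> = (1 - q) * ((1 + q) * q ^ N * qpoch (- (q\<^sup>2)) (q\<^sup>2) N)"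
    by (simp add: algebra_simps power2_eq_square power_add)
  finally have "(1 - q) * ?S = (1 - q) * ((1 + q) * q ^ N * qpoch (- (q\<^sup>2)) (q\<^sup>2) N)" .
  moreover have "1 - q \<noteq> 0"
    using q by (auto simp: fps_eq_iff intro!: exI[of _ 0])
  ultimately show ?thesis by simp
qed

section \<open>The $q$-binomial theorem\<close>

text \<open>Lets limits be treated as congruences: agreement of the first n coefficients becomes
  divisibility of a difference, which is stable under ring operations.\<close>

lemma fps_X_power_dvd_iff: "fps_X ^ n dvd (f :: 'a::comm_ring_1 fps) \<longleftrightarrow> (\<forall>i<n. fps_nth f i = 0)"
proof
  assume "\<forall>i<n. fps_nth f i = 0"
  hence "f = fps_X ^ n * fps_shift n f"
    by (auto simp: fps_eq_iff fps_X_power_mult_nth)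
  thus "fps_X ^ n dvd f" by (rule dvdI)
qed (auto simp: fps_X_power_mult_nth)

lemma fps_X_dvd_iff: "fps_X dvd (f :: 'a::comm_ring_1 fps) \<longleftrightarrow> fps_nth f 0 = 0"
  using fps_X_power_dvd_iff[of 1 f] by simp

lemma qpoch_Suc_shift: "qpoch a q (Suc n) = (1 - a) * qpoch (a * q) q n"
  unfolding qpoch_def by (subst prod.lessThan_Suc_shift) (simp add: mult_ac)

text \<open>The factor appended at index M is 1 modulo X^(M+1), so coefficients below n are frozen
  from the n-th partial product on and agree with those of the limit.\<close>

lemma qpoch_cong_qpoch_inf:
  fixes a q :: "'a::field fps"
  assumes a: "fps_nth a 0 = 0" and q: "fps_nth q 0 = 0"
  shows "fps_X ^ n dvd (qpoch a q n - qpoch_inf a q)"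
  unfolding fps_X_power_dvd_iff
proof (intro allI impI)
  fix i assume "i < n"
  have stable: "fps_nth (qpoch a q M) i = fps_nth (qpoch a q n) i" if "n \<le> M" for M
    using that
  proof (induction M rule: dec_induct)
    case (step M)
    with \<open>i < n\<close> fps_nth_mult_power_eq_0[OF a q, of i M "qpoch a q M"] show ?case
      by (simp add: qpoch_Suc right_diff_distrib)
  qed simp
  have "\<forall>\<^sub>F M in sequentially. fps_nth (qpoch a q M) i = fps_nth (qpoch_inf a q) i"
    using qpoch_tendsto_qpoch_inf[OF a q] unfolding tendsto_fps_iff by blast
  hence "\<forall>\<^sub>F M in sequentially. fps_nth (qpoch a q n) i = fps_nth (qpoch_inf a q) i"
    using eventually_ge_at_top[of n] by eventually_elim (metis stable)
  thus "fps_nth (qpoch a q n - qpoch_inf a q) i = 0" by simp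
qed

text \<open>Splitting off the first factor is exact for finite products; passing to the infinite
  ones leaves an error divisible by every power of X, hence zero.\<close>

lemma qpoch_inf_shift:
  fixes a q :: "'a::field fps"
  assumes a: "fps_nth a 0 = 0" and q: "fps_nth q 0 = 0"
  shows "qpoch_inf a q = (1 - a) * qpoch_inf (a * q) q"
proof -
  have "fps_X ^ n dvd (qpoch_inf a q - (1 - a) * qpoch_inf (a * q) q)" for n
  proof -
    have "fps_X ^ n dvd (qpoch a q (Suc n) - qpoch_inf a q)"
      by (rule dvd_trans[OF _ qpoch_cong_qpoch_inf[OF a q]]) (simp add: le_imp_power_dvd)
    moreover have "fps_X ^ n dvd (1 - a) * (qpoch (a * q) q n - qpoch_inf (a * q) q)"
      using a by (intro dvd_mult qpoch_cong_qpoch_inf q) simp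
    ultimately have "fps_X ^ n dvd ((1 - a) * (qpoch (a * q) q n - qpoch_inf (a * q) q)
        - (qpoch a q (Suc n) - qpoch_inf a q))"
      by (rule dvd_diff[rotated])
    thus ?thesis by (simp add: qpoch_Suc_shift algebra_simps)
  qed
  hence "fps_nth (qpoch_inf a q - (1 - a) * qpoch_inf (a * q) q) i = 0" for i
    unfolding fps_X_power_dvd_iff by blast
  thus ?thesis by (simp add: fps_eq_iff)
qed

context
  fixes a q :: "'a::field fps" and c :: "nat \<Rightarrow> 'a fps"
  assumes q: "fps_nth q 0 = 0"
  defines "c \<equiv> \<lambda>n. qpoch a q n * inverse (qpoch q q n)"
begin

lemma qbinomial_coeff_rec: "(1 - q ^ Suc n) * c (Suc n) = (1 - a * q ^ n) * c n"
proof -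
  have "fps_nth (qpoch q q m) 0 = 1" for m
    unfolding qpoch_def using q by (intro fps_nth_0_prod_one) simp
  hence unit: "qpoch q q m * inverse (qpoch q q m) = 1" for m
    by (simp add: inverse_mult_eq_1')
  have "(1 - q ^ Suc n) * c (Suc n) * qpoch q q n
      = qpoch a q n * (1 - a * q ^ n) * (qpoch q q (Suc n) * inverse (qpoch q q (Suc n)))"
    by (simp add: c_def qpoch_Suc mult_ac)
  also have "\<dots> = (1 - a * q ^ n) * c n * qpoch q q n"
    using unit[of n] unit[of "Suc n"] by (simp add: c_def mult_ac)
  finally show ?thesis
    using unit[of n] by auto
qed

text \<open>The functional equation $(1 - z) G(z) = (1 - a z) G(q z)$, truncated.\<close>
lemma qbinomial_partial_sum_shift:
  "(1 - z) * (\<Sum>n\<le>M. c n * z ^ n) - (1 - a * z) * (\<Sum>n\<le>M. c n * (z * q) ^ n)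
     = - ((1 - a * q ^ M) * c M * z ^ Suc M)"
proof (induction M)
  case 0
  show ?case by (simp add: algebra_simps)
next
  case (Suc M)
  have "(1 - z) * (\<Sum>n\<le>Suc M. c n * z ^ n) - (1 - a * z) * (\<Sum>n\<le>Suc M. c n * (z * q) ^ n)
      = - ((1 - a * q ^ M) * c M * z ^ Suc M)
        + ((1 - z) * z ^ Suc M - (1 - a * z) * (z * q) ^ Suc M) * c (Suc M)"
    unfolding Suc[symmetric] by (simp add: algebra_simps)
  \<comment> \<open>The bracket equals z^(M+1) ((1 - q^(M+1)) - z (1 - a q^(M+1))). By the
    coefficient recurrence its first part cancels the old boundary term, and its second part is the
    new one.\<close>
  also have "\<dots> = - ((1 - a * q ^ Suc M) * c (Suc M) * z ^ Suc (Suc M))"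
    unfolding qbinomial_coeff_rec[of M, symmetric] power_mult_distrib by (simp add: algebra_simps)
  finally show ?case .
qed

text \<open>Iterates the functional equation J times. Each truncation error contains (z q^j)^(M+1),
  which X^(M+1) divides because z has zero constant term.\<close>

lemma qbinomial_partial_sum_cong:
  assumes z: "fps_nth z 0 = 0"
  shows "fps_X ^ Suc M dvd
    ((\<Sum>n\<le>M. c n * z ^ n) * qpoch z q J - qpoch (a * z) q J * (\<Sum>n\<le>M. c n * (z * q ^ J) ^ n))"
proof (induction J)
  case 0
  show ?case by (simp add: qpoch_def)
next
  case (Suc J)
  define P where "P w = (\<Sum>n\<le>M. c n * w ^ n)" for w
  have "fps_X dvd z * q ^ J"
    using z by (simp add: fps_X_dvd_iff)
  hence "fps_X ^ Suc M dvd - ((1 - a * q ^ M) * c M * (z * q ^ J) ^ Suc M)"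
    by (intro iffD2[OF dvd_minus_iff] dvd_mult[OF dvd_power_same])
  hence "fps_X ^ Suc M dvd (1 - z * q ^ J) * P (z * q ^ J) - (1 - a * (z * q ^ J)) * P (z * q ^ J * q)"
    unfolding P_def qbinomial_partial_sum_shift .
  \<comment> \<open>The induction hypothesis times the next factor of (z;q), plus the functional
    equation at z q^J times \<open>qpoch (a * z) q J\<close>; the terms with
    \<open>P (z * q ^ J)\<close> cancel.\<close>
  hence "fps_X ^ Suc M dvd (P z * qpoch z q J - qpoch (a * z) q J * P (z * q ^ J)) * (1 - z * q ^ J)
      + qpoch (a * z) q J
        * ((1 - z * q ^ J) * P (z * q ^ J) - (1 - a * (z * q ^ J)) * P (z * q ^ J * q))"
    by (intro dvd_add dvd_mult dvd_mult2[OF Suc[folded P_def]])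
  moreover have "z * q ^ Suc J = z * q ^ J * q" by (simp add: mult_ac)
  ultimately show ?case
    unfolding P_def[symmetric] by (simp add: qpoch_Suc algebra_simps)
qed

text \<open>Take J = M + 1 in the iterated equation. Modulo X^(M+1) the sum at z q^J reduces to its
  constant term 1 and the finite products agree with the infinite ones; dividing by the unit
  \<open>qpoch_inf z q\<close> finishes.\<close>

lemma qbinomial_theorem_cong:
  assumes z: "fps_nth z 0 = 0"
  shows "fps_X ^ Suc M dvd ((\<Sum>n\<le>M. c n * z ^ n) - qpoch_inf (a * z) q / qpoch_inf z q)"
proof -
  define G H where "G = (\<Sum>n\<le>M. c n * z ^ n)" and "H = (\<Sum>n\<le>M. c n * (z * q ^ Suc M) ^ n)"
  have az: "fps_nth (a * z) 0 = 0" using z by simp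
  have "fps_X dvd q" using q by (simp add: fps_X_dvd_iff)
  hence X: "fps_X ^ Suc M dvd c (Suc n) * (z * q ^ Suc M) ^ Suc n" for n
    unfolding power_Suc[of "z * q ^ Suc M"] by (intro dvd_mult dvd_mult2 dvd_power_same)
  have "H - 1 = (\<Sum>n<M. c (Suc n) * (z * q ^ Suc M) ^ Suc n)"
    unfolding H_def by (subst sum.atMost_shift) (simp add: c_def qpoch_def)
  hence H: "fps_X ^ Suc M dvd H - 1" by (simp only: dvd_sum[OF X])
  have unit: "qpoch_inf z q * inverse (qpoch_inf z q) = 1"
    using fps_nth_0_qpoch_inf[OF z q] by (simp add: inverse_mult_eq_1')
  \<comment> \<open>Four separate errors: the iterated equation, replacing \<open>H\<close> by 1,
    and completing each of the two products.\<close>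
  have "fps_X ^ Suc M dvd
      (G * qpoch z q (Suc M) - qpoch (a * z) q (Suc M) * H)
      + qpoch (a * z) q (Suc M) * (H - 1)
      + (qpoch (a * z) q (Suc M) - qpoch_inf (a * z) q)
      - G * (qpoch z q (Suc M) - qpoch_inf z q)"
    unfolding G_def H_def
    by (rule dvd_diff[OF dvd_add[OF dvd_add[OF qbinomial_partial_sum_cong[OF z] dvd_mult[OF H[unfolded H_def]]]
          qpoch_cong_qpoch_inf[OF az q]] dvd_mult[OF qpoch_cong_qpoch_inf[OF z q]]])
  also have "\<dots> = G * qpoch_inf z q - qpoch_inf (a * z) q"
    by (simp add: algebra_simps)
  finally have "fps_X ^ Suc M dvd (G * qpoch_inf z q - qpoch_inf (a * z) q) * inverse (qpoch_inf z q)"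
    by (rule dvd_mult2)
  also have "\<dots> = G * (qpoch_inf z q * inverse (qpoch_inf z q)) - qpoch_inf (a * z) q / qpoch_inf z q"
    using fps_nth_0_qpoch_inf[OF z q] by (simp add: fps_divide_unit algebra_simps)
  finally show ?thesis by (simp add: unit G_def)
qed

end

section \<open>The identity\<close>

text \<open>A term of weight above d cannot reach the coefficient of X^d. Hence only finitely many
  terms contribute to it, and the partial sum over weights up to d already determines it.\<close>

lemma has_sum_fps_gradedI:
  fixes F :: "'b \<Rightarrow> 'a::comm_ring_1 fps" and wt :: "'b \<Rightarrow> nat"
  assumes fin: "\<And>d. finite {x\<in>A. wt x \<le> d}"
    and F: "\<And>x. x \<in> A \<Longrightarrow> fps_X ^ wt x dvd F x"
    and S: "\<And>d. fps_X ^ Suc d dvd ((\<Sum>x | x \<in> A \<and> wt x \<le> d. F x) - S)"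
  shows "(F has_sum S) A"
proof (rule has_sum_fpsI)
  fix d
  have sub: "{x\<in>A. fps_nth (F x) d \<noteq> 0} \<subseteq> {x\<in>A. wt x \<le> d}"
    using F unfolding fps_X_power_dvd_iff by (auto simp: not_less[symmetric])
  show "finite {x\<in>A. fps_nth (F x) d \<noteq> 0}"
    using finite_subset[OF sub fin] .
  have "fps_nth S d = (\<Sum>x | x \<in> A \<and> wt x \<le> d. fps_nth (F x) d)"
    using S[of d] unfolding fps_X_power_dvd_iff by (simp add: fps_sum_nth)
  also have "\<dots> = (\<Sum>x | x \<in> A \<and> fps_nth (F x) d \<noteq> 0. fps_nth (F x) d)"
    by (rule sum.mono_neutral_right[OF fin sub]) auto
  finally show "fps_nth S d = (\<Sum>x | x \<in> A \<and> fps_nth (F x) d \<noteq> 0. fps_nth (F x) d)" .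
qed

theorem theorem1p17:
  shows "((\<lambda>(n, k). fps_X ^ (2 * k + (n - k)\<^sup>2) * qYamanouchi (fps_X ^ 4) n k
              * inverse (qpoch (fps_X\<^sup>2) (fps_X\<^sup>2) (n + k)) * qint fps_X (2 * (n - k) + 2))
          has_sum (qpoch_inf (- fps_X) (fps_X\<^sup>2) / qpoch_inf fps_X (fps_X\<^sup>2) :: 'a::field_char_0 fps))
          {(n, k). k \<le> n}"
proof (rule has_sum_fps_gradedI[where wt = "\<lambda>(n, k). n + k"])
  let ?A = "{(n::nat, k::nat). k \<le> n}"
  define q :: "'a fps" where "q = fps_X"
  have q: "fps_nth q 0 = 0" and q2: "fps_nth (q\<^sup>2) 0 = 0" by (simp_all add: q_def)
  define F where "F = (\<lambda>(n, k). q ^ (2 * k + (n - k)\<^sup>2) * qYamanouchi (q ^ 4) n k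
              * inverse (qpoch (q\<^sup>2) (q\<^sup>2) (n + k)) * qint q (2 * (n - k) + 2))"
  define S where "S = qpoch_inf (- q) (q\<^sup>2) / qpoch_inf q (q\<^sup>2)"
  show "finite {x \<in> ?A. (case x of (n, k) \<Rightarrow> n + k) \<le> d}" for d
    by (rule finite_subset[of _ "{..d} \<times> {..d}"]) auto
  show "fps_X ^ (case x of (n, k) \<Rightarrow> n + k) dvd (case x of (n, k) \<Rightarrow> 
      fps_X ^ (2 * k + (n - k)\<^sup>2) * qYamanouchi (fps_X ^ 4) n k
      * inverse (qpoch (fps_X\<^sup>2) (fps_X\<^sup>2) (n + k)) * qint (fps_X :: 'a fps) (2 * (n - k) + 2))"
    if "x \<in> ?A" for x
  proof -
    obtain n k where x: "x = (n, k)" "k \<le> n" using \<open>x \<in> ?A\<close> by auto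
    \<comment> \<open>The weight n + k equals 2k + (n - k), so this inequality bounds it by the
      exponent of the monomial factor.\<close>
    have "n - k \<le> (n - k)\<^sup>2" unfolding power2_eq_square by (rule le_square)
    hence "n + k \<le> 2 * k + (n - k)\<^sup>2" using x by linarith
    thus ?thesis by (auto simp: x intro!: dvd_mult2 le_imp_power_dvd)
  qed
  have "fps_X ^ Suc d dvd (\<Sum>x | x \<in> ?A \<and> (case x of (n, k) \<Rightarrow> n + k) \<le> d. F x) - S" for d
  proof -
    \<comment> \<open>Group by N = n + k: the condition k \<le> n becomes 2k \<le> N, so each
      truncation consists of complete sums with fixed N.\<close>
    have "(\<Sum>x | x \<in> ?A \<and> (case x of (n, k) \<Rightarrow> n + k) \<le> d. F x)
        = (\<Sum>(N, k) \<in> (SIGMA N:{..d}. {k. 2 * k \<le> N}). F (N - k, k))"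
      by (rule sum.reindex_bij_witness[of _ "\<lambda>(N, k). (N - k, k)" "\<lambda>(n, k). (n + k, k)"]) auto
    also have "\<dots> = (\<Sum>N\<le>d. \<Sum>k | 2 * k \<le> N. F (N - k, k))"
      by (subst sum.Sigma) (auto intro: finite_subset[OF _ finite_atMost[of d]])
    also have "\<dots> = (\<Sum>N\<le>d. (1 + q) * (qpoch (- (q\<^sup>2)) (q\<^sup>2) N * inverse (qpoch (q\<^sup>2) (q\<^sup>2) N) * q ^ N))"
    proof (rule sum.cong)
      fix N
      have "(\<Sum>k | 2 * k \<le> N. F (N - k, k)) = (\<Sum>k | 2 * k \<le> N. q ^ (2 * k + (N - k - k)\<^sup>2)
          * qYamanouchi (q ^ 4) (N - k) k * qint q (2 * (N - k - k) + 2))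
          * inverse (qpoch (q\<^sup>2) (q\<^sup>2) N)"
        unfolding sum_distrib_right by (rule sum.cong) (auto simp: F_def mult_ac)
      thus "(\<Sum>k | 2 * k \<le> N. F (N - k, k))
          = (1 + q) * (qpoch (- (q\<^sup>2)) (q\<^sup>2) N * inverse (qpoch (q\<^sup>2) (q\<^sup>2) N) * q ^ N)"
        unfolding sum_qYamanouchi_fixed_total[OF q] by (simp only: mult_ac)
    qed simp
    also have "\<dots> = (1 + q) * (\<Sum>N\<le>d. qpoch (- (q\<^sup>2)) (q\<^sup>2) N * inverse (qpoch (q\<^sup>2) (q\<^sup>2) N) * q ^ N)"
      by (simp only: sum_distrib_left)
    finally have sum: "(\<Sum>x | x \<in> ?A \<and> (case x of (n, k) \<Rightarrow> n + k) \<le> d. F x) = \<dots>" .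
    \<comment> \<open>The q-binomial theorem is applied with base q^2, a = -q^2 and z = q, so its
      numerator is the product starting at 1 + q^3. The common factor 1 + q of the fixed-N sums
      supplies the missing first factor.\<close>
    have "qpoch_inf (- q) (q\<^sup>2) = (1 + q) * qpoch_inf (- (q\<^sup>2) * q) (q\<^sup>2)"
      using qpoch_inf_shift[of "- q" "q\<^sup>2"] q by (simp add: mult_ac)
    hence S: "S = (1 + q) * (qpoch_inf (- (q\<^sup>2) * q) (q\<^sup>2) / qpoch_inf q (q\<^sup>2))"
      unfolding S_def using fps_nth_0_qpoch_inf[OF q q2] by (simp add: fps_divide_unit mult_ac)
    show ?thesis
      unfolding sum S right_diff_distrib[symmetric]
      by (intro dvd_mult[OF qbinomial_theorem_cong] q q2)
  qed
  thus "fps_X ^ Suc d dvd (\<Sum>x | x \<in> ?A \<and> (case x of (n, k) \<Rightarrow> n + k) \<le> d. case x of (n, k) \<Rightarrow> 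
      fps_X ^ (2 * k + (n - k)\<^sup>2) * qYamanouchi (fps_X ^ 4) n k
      * inverse (qpoch (fps_X\<^sup>2) (fps_X\<^sup>2) (n + k)) * qint fps_X (2 * (n - k) + 2))
      - qpoch_inf (- fps_X) (fps_X\<^sup>2) / qpoch_inf (fps_X :: 'a fps) (fps_X\<^sup>2)" for d
    unfolding F_def S_def q_def .
qed

end
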